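(* Let $n\ge1$, let $I_n$ be the final index of the Bernoulli clock with $n$ pairs (defined in the context), and let $\delta_{k:2n}=\frac{1}{2n}-\mathbb{P}(I_n=k)$ for $1\le k\le 2n$. Then $$\delta_{2n+1-k:2n}=(-1)^n\,\delta_{k:2n}\qquad\text{for all } 1\le k\le 2n.$$
   Context: Bernoulli clock: let $U_1,U_1',\dots,U_n,U_n'$ be i.i.d. uniform on the circle $\mathbb{T}=\mathbb{R}/\mathbb{Z}=[0,1)$ of circumference $1$ (almost surely all distinct), with order statistics $U_{1:2n}<\dots<U_{2n:2n}$ in $[0,1)$. "Clockwise" means the direction of increasing coordinate, wrapping around from $1$ to $0$. Starting from $0$ move clockwise to the first of $U_1,U_1'$ encountered; then for $k=2,\dots,n$ in turn continue clockwise from the current position to whichever of $U_k,U_k'$ is encountered first. For $1\le k\le n$, $I_k\in\{1,\dots,2n\}$ is the random index such that the position reached at step $k$ is $U_{I_k:2n}$. *)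

theory Defs
  imports "HOL-Probability.Probability"
begin

text \<open>
  The circle of circumference 1 is represented by the coordinates in the half-open interval from
  0 to 1. Travelling clockwise (in the direction of increasing coordinate, wrapping from 1 to 0),
  the distance from \<open>x\<close> to \<open>y\<close> is the fractional part of \<open>y - x\<close>.
\<close>

definition clockwise_dist :: "real \<Rightarrow> real \<Rightarrow> real" where
  "clockwise_dist x y = frac (y - x)"

definition first_clockwise :: "real \<Rightarrow> real \<Rightarrow> real \<Rightarrow> real" where
  "first_clockwise x u u' = (if clockwise_dist x u \<le> clockwise_dist x u' then u else u')"

primrec clock_pos :: "(nat \<Rightarrow> real) \<Rightarrow> (nat \<Rightarrow> real) \<Rightarrow> nat \<Rightarrow> real" where
  "clock_pos u u' 0 = 0"
| "clock_pos u u' (Suc k) = first_clockwise (clock_pos u u' k) (u (Suc k)) (u' (Suc k))"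

definition clock_order_stat :: "nat \<Rightarrow> (nat \<Rightarrow> real) \<Rightarrow> (nat \<Rightarrow> real) \<Rightarrow> nat \<Rightarrow> real" where
  "clock_order_stat n u u' i = sort (map u [1..<Suc n] @ map u' [1..<Suc n]) ! (i - 1)"

text \<open>
  For \<open>1 \<le> k \<le> n\<close> an index as below exists, and it is unique when the \<open>2 * n\<close> points are distinct.
  The least one is taken only to settle the null event of coinciding points.
\<close>

definition clock_index :: "nat \<Rightarrow> (nat \<Rightarrow> real) \<Rightarrow> (nat \<Rightarrow> real) \<Rightarrow> nat \<Rightarrow> nat" where
  "clock_index n u u' k =
     (LEAST i. i \<in> {1..2 * n} \<and> clock_order_stat n u u' i = clock_pos u u' k)"

definition clock_delta ::
    "'a measure \<Rightarrow> nat \<Rightarrow> (nat \<Rightarrow> 'a \<Rightarrow> real) \<Rightarrow> (nat \<Rightarrow> 'a \<Rightarrow> real) \<Rightarrow> nat \<Rightarrow> real" where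
  "clock_delta M n U U' k =
     1 / (2 * real n)
     - measure M {\<omega> \<in> space M. clock_index n (\<lambda>i. U i \<omega>) (\<lambda>i. U' i \<omega>) n = k}"

end

theory Submission
  imports Defs
begin

text \<open>
  The final position depends only on the cyclic order of the starting point and the
  \<open>2 * n\<close> points, so \<open>I\<^sub>n\<close> is a function of the ranks of the points, and by exchangeability these
  ranks form a uniformly distributed bijection from the \<open>2 * n\<close> labels onto \<open>{1..2 * n}\<close>
  (\<open>prob_rank_fn_in\<close>, \<open>clock_index_eq_walk\<close>). What remains is a counting statement.

  Generalise the clock by prescribing a direction for every step: in a clockwise step the walk moves
  to the point of the current pair that it meets first when travelling clockwise, in an anticlockwise
  step to the other one, which is the first it meets when travelling anticlockwise. Consider two
  direction sequences that differ exactly at step \<open>j\<close>. After step \<open>j\<close> one of the two walks stands at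
  \<open>U\<^sub>j\<close>, the other at \<open>U'\<^sub>j\<close>, whatever happened before, and from there both follow the same rules. A walk
  that starts at a labelled point commutes with cyclic shifts of the ranks, so its final rank is
  uniform on \<open>{1..2 * n}\<close> (\<open>card_level_set_uniform\<close>). Hence the two final ranks
  have laws with average exactly uniform: reversing one step negates the deviation from the uniform
  law (\<open>walk_count_flip\<close>). Reversing all \<open>n\<close> steps multiplies this deviation by \<open>(- 1) ^ n\<close>. On the
  other hand, reversing all steps is the same as reflecting the circle, which replaces rank \<open>k\<close>
  by \<open>2 * n + 1 - k\<close> (\<open>walk_count_reflect\<close>).
\<close>

section \<open>Ranks\<close>

text \<open>
  The rank of each element of \<open>A\<close> in the order of the values \<open>x\<close>, counted from 1; the function is
  undefined outside \<open>A\<close>, so that rank functions can be compared for equality.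
\<close>

definition rank_fn :: "'i set \<Rightarrow> ('i \<Rightarrow> 'b::linorder) \<Rightarrow> 'i \<Rightarrow> nat" where
  "rank_fn A x = (\<lambda>a\<in>A. card {b \<in> A. x b \<le> x a})"

text \<open>
  The possible rank functions of an injective \<open>x\<close> on \<open>A\<close>: the bijections from \<open>A\<close> onto
  \<open>{1..card A}\<close>, again undefined outside \<open>A\<close>.
\<close>

definition rankings :: "'i set \<Rightarrow> ('i \<Rightarrow> nat) set" where
  "rankings A = {R \<in> A \<rightarrow>\<^sub>E {1..card A}. bij_betw R A {1..card A}}"

lemma finite_rankings: "finite A \<Longrightarrow> finite (rankings A)"
  unfolding rankings_def by (simp add: finite_PiE)

lemma rank_fn_le_iff:
  assumes "finite A" "a \<in> A" "b \<in> A"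
  shows "rank_fn A x a \<le> rank_fn A x b \<longleftrightarrow> x a \<le> x b"
proof
  assume "x a \<le> x b"
  then have "{c \<in> A. x c \<le> x a} \<subseteq> {c \<in> A. x c \<le> x b}" by auto
  then show "rank_fn A x a \<le> rank_fn A x b"
    using assms by (auto simp: rank_fn_def intro: card_mono)
next
  assume le: "rank_fn A x a \<le> rank_fn A x b"
  show "x a \<le> x b"
  proof (rule ccontr)
    assume "\<not> x a \<le> x b"
    then have "{c \<in> A. x c \<le> x b} \<subset> {c \<in> A. x c \<le> x a}"
      using assms by force
    then have "card {c \<in> A. x c \<le> x b} < card {c \<in> A. x c \<le> x a}"
      using assms by (intro psubset_card_mono) auto
    then show False using le assms by (simp add: rank_fn_def)
  qed
qed

lemma rank_fn_in_rankings:
  assumes "finite A" "inj_on x A"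
  shows "rank_fn A x \<in> rankings A"
proof -
  have mem: "rank_fn A x a \<in> {1..card A}" if "a \<in> A" for a
  proof -
    have "card {b \<in> A. x b \<le> x a} \<le> card A" using assms by (intro card_mono) auto
    moreover have "card {b \<in> A. x b \<le> x a} \<noteq> 0" using assms that by auto
    ultimately show ?thesis using that by (simp add: rank_fn_def)
  qed
  have "inj_on (rank_fn A x) A"
  proof (rule inj_onI)
    fix a b assume ab: "a \<in> A" "b \<in> A" "rank_fn A x a = rank_fn A x b"
    then have "x a = x b" using rank_fn_le_iff[OF assms(1)] by (metis order.antisym order.refl)
    then show "a = b" using ab assms(2) by (auto dest: inj_onD)
  qed
  then have "bij_betw (rank_fn A x) A {1..card A}"
    using mem by (intro bij_betw_imageI card_subset_eq) (auto simp: card_image)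
  then show ?thesis using mem unfolding rankings_def by (auto simp: rank_fn_def)
qed

lemma rankings_nonempty:
  assumes "finite A"
  shows "rankings A \<noteq> {}"
proof -
  obtain f :: "'a \<Rightarrow> nat" where "inj_on f A"
    using finite_imp_inj_to_nat_seg[OF assms] by auto
  then show ?thesis using rank_fn_in_rankings[OF assms] by blast
qed

lemma rankings_compose:
  assumes "R \<in> rankings A" "bij_betw c {1..card A} {1..card A}"
  shows "restrict (c \<circ> R) A \<in> rankings A"
proof -
  have "bij_betw (restrict (c \<circ> R) A) A {1..card A}"
    using assms bij_betw_trans unfolding rankings_def by (subst bij_betw_restrict_eq) blast
  then show ?thesis by (auto simp: rankings_def bij_betw_def)
qed

lemma rank_fn_reindex:
  assumes "bij_betw \<rho> A A" "a \<in> A"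
  shows "rank_fn A (\<lambda>a. x (\<rho> a)) a = rank_fn A x (\<rho> a)"
proof -
  have "\<rho> ` {b \<in> A. x (\<rho> b) \<le> x (\<rho> a)} = {c \<in> A. x c \<le> x (\<rho> a)}"
    using assms(1) by (auto simp: bij_betw_def)
  moreover have "inj_on \<rho> {b \<in> A. x (\<rho> b) \<le> x (\<rho> a)}"
    using assms(1) by (auto simp: bij_betw_def inj_on_def)
  ultimately have "card {b \<in> A. x (\<rho> b) \<le> x (\<rho> a)} = card {c \<in> A. x c \<le> x (\<rho> a)}"
    using card_image[of \<rho> "{b \<in> A. x (\<rho> b) \<le> x (\<rho> a)}"] by simp
  moreover have "\<rho> a \<in> A" using assms by (auto simp: bij_betw_def)
  ultimately show ?thesis using assms(2) by (simp only: rank_fn_def restrict_apply if_True)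
qed

section \<open>Ranks of independent identically distributed variables\<close>

lemma measurable_card_Collect:
  assumes "finite A" "\<And>b. b \<in> A \<Longrightarrow> Measurable.pred M (\<lambda>\<omega>. P b \<omega>)"
  shows "(\<lambda>\<omega>. card {b \<in> A. P b \<omega>}) \<in> measurable M (count_space UNIV)"
  using assms
proof (induction A rule: finite_induct)
  case (insert a A)
  have [measurable]: "Measurable.pred M (P a)" using insert.prems by simp
  have [measurable]: "(\<lambda>\<omega>. card {b \<in> A. P b \<omega>}) \<in> measurable M (count_space UNIV)"
    using insert by simp
  have "{b \<in> insert a A. P b \<omega>} = (if P a \<omega> then insert a {b \<in> A. P b \<omega>} else {b \<in> A. P b \<omega>})" for \<omega>
    by auto
  then have "card {b \<in> insert a A. P b \<omega>}
      = (if P a \<omega> then Suc (card {b \<in> A. P b \<omega>}) else card {b \<in> A. P b \<omega>})" for \<omega>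
    using insert.hyps by simp
  then show ?case by simp
qed simp

lemma rank_fn_eq_iff:
  assumes "R \<in> rankings A"
  shows "rank_fn A x = R \<longleftrightarrow> (\<forall>a\<in>A. card {b \<in> A. x b \<le> x a} = R a)"
  using assms unfolding rankings_def rank_fn_def
  by (auto simp: fun_eq_iff PiE_def extensional_def)

lemma pred_rank_fn_eq:
  assumes "finite A" "R \<in> rankings A" "\<And>a. a \<in> A \<Longrightarrow> X a \<in> borel_measurable M"
  shows "Measurable.pred M (\<lambda>\<omega>. rank_fn A (\<lambda>a. X a \<omega>::real) = R)"
proof -
  have "Measurable.pred M (\<lambda>\<omega>. card {b \<in> A. X b \<omega> \<le> X a \<omega>} = R a)" if "a \<in> A" for a
  proof -
    note [measurable] = assms(3)
    have "(\<lambda>\<omega>. card {b \<in> A. X b \<omega> \<le> X a \<omega>}) \<in> measurable M (count_space UNIV)"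
      using assms that by (intro measurable_card_Collect) auto
    then show ?thesis by measurable
  qed
  then show ?thesis unfolding rank_fn_eq_iff[OF assms(2)]
    using assms(1) by (intro pred_intros_finite) auto
qed

context prob_space
begin

text \<open>
  Any two rankings differ by a permutation \<open>\<rho>\<close> of \<open>A\<close>, and permuting the variables by \<open>\<rho>\<close> leaves their
  joint law, a power of \<open>D\<close>, unchanged.
\<close>

lemma prob_rank_fn_eq_cong:
  fixes X :: "'i \<Rightarrow> 'a \<Rightarrow> real"
  assumes A: "finite A" "A \<noteq> {}" and ind: "indep_vars (\<lambda>_. borel) X A"
    and D: "\<And>a. a \<in> A \<Longrightarrow> distr M borel (X a) = D"
    and R: "R \<in> rankings A" and R': "R' \<in> rankings A"
  shows "prob {\<omega> \<in> space M. rank_fn A (\<lambda>a. X a \<omega>) = R}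
       = prob {\<omega> \<in> space M. rank_fn A (\<lambda>a. X a \<omega>) = R'}"
proof -
  have bR: "bij_betw R A {1..card A}" and bR': "bij_betw R' A {1..card A}"
    using R R' unfolding rankings_def by auto
  define \<rho> where "\<rho> = inv_into A R \<circ> R'"
  have \<rho>: "bij_betw \<rho> A A"
    unfolding \<rho>_def using bR' bij_betw_inv_into[OF bR] by (rule bij_betw_trans)
  have \<rho>A: "\<rho> ` A = A" using \<rho> by (simp add: bij_betw_def)
  have R\<rho>: "R (\<rho> a) = R' a" if "a \<in> A" for a
    using that bR bR' unfolding \<rho>_def comp_def
    by (intro f_inv_into_f) (auto simp: bij_betw_def)
  have Xm: "X a \<in> borel_measurable M" if "a \<in> A" for a
    using ind that by (simp add: indep_vars_def2)
  have Xm': "X (\<rho> a) \<in> borel_measurable M" if "a \<in> A" for a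
    using that \<rho>A Xm by auto
  have 1: "distr M (PiM A (\<lambda>_. borel)) (\<lambda>\<omega>. \<lambda>a\<in>A. X a \<omega>) = PiM A (\<lambda>_. D)"
    using indep_vars_iff_distr_eq_PiM'[of A X "\<lambda>_. borel"] A Xm ind D
    by (simp cong: PiM_cong)
  have 2: "distr M (PiM A (\<lambda>_. borel)) (\<lambda>\<omega>. \<lambda>a\<in>A. X (\<rho> a) \<omega>) = PiM A (\<lambda>_. D)"
  proof -
    obtain a0 where a0: "a0 \<in> A" using A by auto
    have "prob_space D" using D[OF a0] prob_space_distr[OF Xm[OF a0]] by simp
    have sets_D: "sets D = sets borel" using D[OF a0] by (metis sets_distr)
    have m: "(\<lambda>f. \<lambda>a\<in>A. f (\<rho> a)) \<in> measurable (PiM A (\<lambda>_. borel)) (PiM A (\<lambda>_. borel :: real measure))"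
      using \<rho>A by (intro measurable_restrict measurable_component_singleton) auto
    have "distr M (PiM A (\<lambda>_. borel)) (\<lambda>\<omega>. \<lambda>a\<in>A. X (\<rho> a) \<omega>)
        = distr M (PiM A (\<lambda>_. borel)) ((\<lambda>f. \<lambda>a\<in>A. f (\<rho> a)) \<circ> (\<lambda>\<omega>. \<lambda>a\<in>A. X a \<omega>))"
      using \<rho>A by (intro arg_cong[where f="distr M (PiM A (\<lambda>_. borel))"]) (auto simp: fun_eq_iff)
    also have "\<dots> = distr (PiM A (\<lambda>_. D)) (PiM A (\<lambda>_. borel)) (\<lambda>f. \<lambda>a\<in>A. f (\<rho> a))"
      unfolding 1[symmetric] using m Xm by (intro distr_distr[symmetric]) (auto intro: measurable_restrict)
    also have "\<dots> = distr (PiM A (\<lambda>_. D)) (PiM A (\<lambda>_. D)) (\<lambda>f. \<lambda>a\<in>A. f (\<rho> a))"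
      by (intro distr_cong sets_PiM_cong refl) (simp_all add: sets_D)
    also have "\<dots> = PiM A (\<lambda>_. D)"
      using \<open>prob_space D\<close> \<rho> distr_PiM_reindex[of A "\<lambda>_. D" \<rho> A] by (auto simp: bij_betw_def)
    finally show ?thesis .
  qed
  define S where "S = {f \<in> space (PiM A (\<lambda>_. borel :: real measure)). rank_fn A f = R'}"
  have S: "S \<in> sets (PiM A (\<lambda>_. borel))"
    unfolding S_def using pred_rank_fn_eq[OF A(1) R', of "\<lambda>a f. f a" "PiM A (\<lambda>_. borel)"]
    by (simp add: pred_def)
  have res: "rank_fn A (\<lambda>a\<in>A. f a) = rank_fn A f" for f :: "'i \<Rightarrow> real"
    unfolding rank_fn_def by (intro restrict_ext arg_cong[where f=card]) auto
  have iff: "rank_fn A (\<lambda>a. x (\<rho> a)) = R' \<longleftrightarrow> rank_fn A x = R" for x :: "'i \<Rightarrow> real"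
  proof -
    have "rank_fn A (\<lambda>a. x (\<rho> a)) = R' \<longleftrightarrow> (\<forall>a\<in>A. rank_fn A x (\<rho> a) = R' a)"
      unfolding rank_fn_eq_iff[OF R'] using rank_fn_reindex[OF \<rho>, of _ x]
      by (auto simp: rank_fn_def)
    also have "\<dots> \<longleftrightarrow> (\<forall>a\<in>A. rank_fn A x (\<rho> a) = R (\<rho> a))" using R\<rho> by simp
    also have "\<dots> \<longleftrightarrow> (\<forall>c\<in>\<rho> ` A. rank_fn A x c = R c)" by simp
    also have "\<dots> \<longleftrightarrow> rank_fn A x = R"
      unfolding \<rho>A rank_fn_eq_iff[OF R] by (simp add: rank_fn_def)
    finally show ?thesis .
  qed
  have "prob {\<omega> \<in> space M. rank_fn A (\<lambda>a. X a \<omega>) = R}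
      = measure (distr M (PiM A (\<lambda>_. borel)) (\<lambda>\<omega>. \<lambda>a\<in>A. X (\<rho> a) \<omega>)) S"
    using S Xm' by (subst measure_distr)
      (auto intro!: measurable_restrict arg_cong[where f=prob]
        simp: S_def res iff[of "\<lambda>a. X a \<omega>" for \<omega>] space_PiM)
  also have "\<dots> = measure (distr M (PiM A (\<lambda>_. borel)) (\<lambda>\<omega>. \<lambda>a\<in>A. X a \<omega>)) S"
    unfolding 1 2 ..
  also have "\<dots> = prob {\<omega> \<in> space M. rank_fn A (\<lambda>a. X a \<omega>) = R'}"
    using S Xm by (subst measure_distr)
      (auto intro!: measurable_restrict arg_cong[where f=prob] simp: S_def res space_PiM)
  finally show ?thesis .
qed

lemma AE_inj_on_indep_vars:
  fixes X :: "'i \<Rightarrow> 'a \<Rightarrow> real"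
  assumes A: "finite A" and ind: "indep_vars (\<lambda>_. borel) X A"
    and atomless: "\<And>a t. a \<in> A \<Longrightarrow> emeasure (distr M borel (X a)) {t} = 0"
  shows "AE \<omega> in M. inj_on (\<lambda>a. X a \<omega>) A"
proof -
  have Xm: "X a \<in> borel_measurable M" if "a \<in> A" for a
    using ind that by (simp add: indep_vars_def2)
  have ne: "AE \<omega> in M. X a \<omega> \<noteq> X b \<omega>" if ab: "a \<in> A" "b \<in> A" "a \<noteq> b" for a b
  proof -
    have [measurable]: "X a \<in> borel_measurable M" "X b \<in> borel_measurable M"
      using Xm ab by auto
    interpret a: prob_space "distr M borel (X a)" by (rule prob_space_distr) simp
    interpret b: prob_space "distr M borel (X b)" by (rule prob_space_distr) simp
    interpret ab: pair_sigma_finite "distr M borel (X a)" "distr M borel (X b)" ..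
    have "indep_var borel ((\<lambda>f. f a) \<circ> (\<lambda>\<omega>. \<lambda>i\<in>{a}. X i \<omega>)) borel ((\<lambda>f. f b) \<circ> (\<lambda>\<omega>. \<lambda>i\<in>{b}. X i \<omega>))"
      using ab by (intro indep_var_compose[OF indep_var_restrict[OF ind]]) auto
    also have "(\<lambda>f. f a) \<circ> (\<lambda>\<omega>. \<lambda>i\<in>{a}. X i \<omega>) = X a" by auto
    also have "(\<lambda>f. f b) \<circ> (\<lambda>\<omega>. \<lambda>i\<in>{b}. X i \<omega>) = X b" by auto
    finally have "indep_var borel (X a) borel (X b)" .
    then have eq: "distr M (borel \<Otimes>\<^sub>M borel) (\<lambda>\<omega>. (X a \<omega>, X b \<omega>))
        = distr M borel (X a) \<Otimes>\<^sub>M distr M borel (X b)"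
      using indep_var_distribution_eq[of borel "X a" borel "X b"] by simp
    have "AE p in distr M borel (X a) \<Otimes>\<^sub>M distr M borel (X b). fst p \<noteq> snd p"
    proof (rule ab.AE_pair_measure)
      show "{p \<in> space (distr M borel (X a) \<Otimes>\<^sub>M distr M borel (X b)). fst p \<noteq> snd p}
        \<in> sets (distr M borel (X a) \<Otimes>\<^sub>M distr M borel (X b))"
        by measurable
      have "AE y in distr M borel (X b). x \<noteq> y" for x
        using atomless[OF ab(2), of x] by (intro AE_I[where N="{x}"]) auto
      then show "AE x in distr M borel (X a). AE y in distr M borel (X b). fst (x, y) \<noteq> snd (x, y)"
        by simp
    qed
    then have "AE p in distr M (borel \<Otimes>\<^sub>M borel) (\<lambda>\<omega>. (X a \<omega>, X b \<omega>)). fst p \<noteq> snd p"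
      unfolding eq .
    then show ?thesis by (subst (asm) AE_distr_iff) auto
  qed
  have "AE \<omega> in M. \<forall>a\<in>A. \<forall>b\<in>A. a \<noteq> b \<longrightarrow> X a \<omega> \<noteq> X b \<omega>"
    using A ne by (auto intro!: AE_finite_allI)
  then show ?thesis by (rule AE_mp) (auto simp: inj_on_def)
qed

text \<open>
  The rank function of independent variables with a common atomless law is uniformly distributed on
  the rankings.
\<close>

lemma prob_rank_fn_in:
  fixes X :: "'i \<Rightarrow> 'a \<Rightarrow> real"
  assumes A: "finite A" "A \<noteq> {}" and ind: "indep_vars (\<lambda>_. borel) X A"
    and D: "\<And>a. a \<in> A \<Longrightarrow> distr M borel (X a) = D"
    and atomless: "\<And>t. emeasure D {t} = 0"
    and S: "S \<subseteq> rankings A"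
  shows "{\<omega> \<in> space M. rank_fn A (\<lambda>a. X a \<omega>) \<in> S} \<in> events"
    and "prob {\<omega> \<in> space M. rank_fn A (\<lambda>a. X a \<omega>) \<in> S} = card S / card (rankings A)"
proof -
  define E where "E R = {\<omega> \<in> space M. rank_fn A (\<lambda>a. X a \<omega>) = R}" for R
  have Xm: "X a \<in> borel_measurable M" if "a \<in> A" for a
    using ind that by (simp add: indep_vars_def2)
  have Em: "E R \<in> events" if "R \<in> rankings A" for R
    using pred_rank_fn_eq[OF A(1) that Xm] by (simp add: E_def pred_def)
  have fin: "finite (rankings A)" using A by (simp add: finite_rankings)
  have un: "{\<omega> \<in> space M. rank_fn A (\<lambda>a. X a \<omega>) \<in> T} = (\<Union>R\<in>T. E R)" for T
    by (auto simp: E_def)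
  have union: "(\<Union>R\<in>T. E R) \<in> events" if "T \<subseteq> rankings A" for T
    using that fin Em by (intro sets.finite_UN) (auto intro: finite_subset)
  show "{\<omega> \<in> space M. rank_fn A (\<lambda>a. X a \<omega>) \<in> S} \<in> events"
    unfolding un by (rule union[OF S])
  have AE: "AE \<omega> in M. rank_fn A (\<lambda>a. X a \<omega>) \<in> rankings A"
    using AE_inj_on_indep_vars[OF A(1) ind] D atomless
    by (auto elim!: AE_mp simp: rank_fn_in_rankings A)
  have total: "prob (\<Union>R\<in>rankings A. E R) = 1"
    using AE union[OF order.refl] by (subst prob_eq_1) (auto simp: E_def)
  then have "rankings A \<noteq> {}" by auto
  then obtain R0 where R0: "R0 \<in> rankings A" by auto
  have sum: "prob (\<Union>R\<in>T. E R) = card T * prob (E R0)" if T: "T \<subseteq> rankings A" for T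
  proof -
    have "prob (\<Union>R\<in>T. E R) = (\<Sum>R\<in>T. prob (E R))"
      using T Em fin by (intro finite_measure_finite_Union)
        (auto intro: finite_subset simp: disjoint_family_on_def E_def)
    also have "\<dots> = (\<Sum>R\<in>T. prob (E R0))"
      using T R0 unfolding E_def by (intro sum.cong refl prob_rank_fn_eq_cong[OF A ind D]) auto
    finally show ?thesis by simp
  qed
  have "card (rankings A) * prob (E R0) = 1" using total sum[of "rankings A"] by simp
  then have "prob (E R0) = 1 / card (rankings A)"
    by (metis mult_zero_left nonzero_mult_div_cancel_left zero_neq_one)
  then show "prob {\<omega> \<in> space M. rank_fn A (\<lambda>a. X a \<omega>) \<in> S} = card S / card (rankings A)"
    unfolding un sum[OF S] by simp
qed

end

section \<open>Walks along a cyclic order\<close>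

text \<open>
  Travelling upwards from \<open>p\<close> and wrapping around, \<open>y\<close> is met no later than \<open>z\<close>. Only the linear order
  is used, so the definition applies to points of the circle and to ranks alike.
\<close>

definition cyclic_le :: "'b::linorder \<Rightarrow> 'b \<Rightarrow> 'b \<Rightarrow> bool" where
  "cyclic_le p y z = (if (p \<le> y) = (p \<le> z) then y \<le> z else p \<le> y)"

text \<open>
  One step of the walk from position \<open>p\<close>, using the \<open>i\<close>-th pair of values, labelled \<open>Inl i\<close> and
  \<open>Inr i\<close>. If \<open>d i\<close> holds the step is clockwise; otherwise the walk moves to the other point of the pair.
\<close>

definition clock_step :: "(nat + nat \<Rightarrow> 'b::linorder) \<Rightarrow> (nat \<Rightarrow> bool) \<Rightarrow> 'b \<Rightarrow> nat \<Rightarrow> 'b" where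
  "clock_step R d p i = (if cyclic_le p (R (Inl i)) (R (Inr i)) = d i then R (Inl i) else R (Inr i))"

text \<open>
  The labels of the \<open>2 * n\<close> points: \<open>Inl i\<close> stands for \<open>U\<^sub>i\<close>, \<open>Inr i\<close> for \<open>U'\<^sub>i\<close>.
\<close>

definition labels :: "nat \<Rightarrow> (nat + nat) set" where
  "labels n = {1..n} <+> {1..n}"

text \<open>
  The final rank of the walk with directions \<open>d\<close> on the ranks \<open>R\<close>. The starting point \<open>0\<close> of the circle
  is represented by the rank 0, below all ranks of labelled points.
\<close>

definition walk :: "nat \<Rightarrow> (nat \<Rightarrow> bool) \<Rightarrow> (nat + nat \<Rightarrow> nat) \<Rightarrow> nat" where
  "walk n d R = foldl (clock_step R d) 0 [1..<Suc n]"

lemma finite_labels [simp]: "finite (labels n)"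
  by (simp add: labels_def)

lemma card_labels [simp]: "card (labels n) = 2 * n"
  by (simp add: labels_def card_Plus)

lemma Inl_in_labels [simp]: "Inl i \<in> labels n \<longleftrightarrow> i \<in> {1..n}"
  and Inr_in_labels [simp]: "Inr i \<in> labels n \<longleftrightarrow> i \<in> {1..n}"
  by (auto simp: labels_def)

lemma foldl_clock_step_in:
  assumes "set js \<subseteq> {1..n}" "p \<in> V" "R ` labels n \<subseteq> V"
  shows "foldl (clock_step R d) p js \<in> V"
  using assms(1,2)
proof (induction js arbitrary: p)
  case (Cons i js)
  then have "clock_step R d p i \<in> V"
    using assms(3) by (auto simp: clock_step_def image_subset_iff)
  then show ?case using Cons by simp
qed simp

lemma walk_eq_label:
  assumes "1 \<le> n"
  obtains a where "a \<in> {Inl n, Inr n}" "walk n d R = R a"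
proof -
  have "[1..<Suc n] = [1..<n] @ [n]" using assms by (simp add: upt_Suc)
  then have "walk n d R = clock_step R d (foldl (clock_step R d) 0 [1..<n]) n"
    by (simp add: walk_def)
  then show ?thesis using that by (auto simp: clock_step_def split: if_splits)
qed

lemma walk_cong:
  assumes "\<And>i. i \<in> {1..n} \<Longrightarrow> d i = e i"
  shows "walk n d R = walk n e R"
  unfolding walk_def by (intro foldl_cong) (use assms in \<open>auto simp: clock_step_def\<close>)

section \<open>Rotating the ranks\<close>

text \<open>
  The cyclic shift of \<open>{1..N}\<close>.
\<close>

definition cyclic_Suc :: "nat \<Rightarrow> nat \<Rightarrow> nat" where
  "cyclic_Suc N r = (if r < N then Suc r else 1)"

lemma cyclic_le_cyclic_Suc:
  assumes "p \<in> {1..N}" "y \<in> {1..N}" "z \<in> {1..N}" "y \<noteq> z"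
  shows "cyclic_le (cyclic_Suc N p) (cyclic_Suc N y) (cyclic_Suc N z) = cyclic_le p y z"
  using assms unfolding cyclic_le_def cyclic_Suc_def by auto

lemma rankings_labels:
  assumes "R \<in> rankings (labels n)"
  shows "R ` labels n = {1..2 * n}" "inj_on R (labels n)"
  using assms by (auto simp: rankings_def bij_betw_def)

lemma rankings_pair:
  assumes "R \<in> rankings (labels n)" "i \<in> {1..n}"
  shows "R (Inl i) \<in> {1..2 * n}" "R (Inr i) \<in> {1..2 * n}" "R (Inl i) \<noteq> R (Inr i)"
  using assms rankings_labels[OF assms(1)] by (auto dest!: inj_onD)

lemma bij_cyclic_Suc: "bij_betw (cyclic_Suc N) {1..N} {1..N}"
proof -
  have "inj_on (cyclic_Suc N) {1..N}"
    by (auto simp: cyclic_Suc_def inj_on_def split: if_splits)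
  moreover have "cyclic_Suc N ` {1..N} \<subseteq> {1..N}"
    by (auto simp: cyclic_Suc_def)
  ultimately show ?thesis by (simp add: bij_betw_def endo_inj_surj)
qed

lemma foldl_clock_step_rotate:
  assumes R: "R \<in> rankings (labels n)" and "set js \<subseteq> {1..n}" "p \<in> {1..2 * n}"
  shows "foldl (clock_step (restrict (cyclic_Suc (2 * n) \<circ> R) (labels n)) d) (cyclic_Suc (2 * n) p) js
       = cyclic_Suc (2 * n) (foldl (clock_step R d) p js)"
proof -
  define R' where "R' = restrict (cyclic_Suc (2 * n) \<circ> R) (labels n)"
  have "foldl (clock_step R' d) (cyclic_Suc (2 * n) p) js = cyclic_Suc (2 * n) (foldl (clock_step R d) p js)"
    using assms(2,3)
  proof (induction js arbitrary: p)
    case (Cons i js)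
    then have i: "i \<in> {1..n}" by simp
    have "clock_step R' d (cyclic_Suc (2 * n) p) i = cyclic_Suc (2 * n) (clock_step R d p i)"
      using i cyclic_le_cyclic_Suc[OF Cons.prems(2) rankings_pair[OF R i]]
      by (simp add: clock_step_def R'_def)
    moreover have "clock_step R d p i \<in> {1..2 * n}"
      using rankings_pair[OF R i] by (simp add: clock_step_def)
    ultimately show ?case using Cons by simp
  qed simp
  then show ?thesis by (simp only: R'_def)
qed

text \<open>
  A statistic of rankings that commutes with the cyclic shift takes all its values equally often:
  shifting gives injections between consecutive level sets, which form a cycle.
\<close>

lemma card_level_set_uniform:
  assumes A: "finite A" and k: "k \<in> {1..card A}"
    and F: "\<And>R. R \<in> rankings A \<Longrightarrow> F R \<in> {1..card A}"
    and eqv: "\<And>R. R \<in> rankings A \<Longrightarrow>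
      F (restrict (cyclic_Suc (card A) \<circ> R) A) = cyclic_Suc (card A) (F R)"
  shows "card A * card {R \<in> rankings A. F R = k} = card (rankings A)"
proof -
  define N where "N = card A"
  define W where "W k = card {R \<in> rankings A. F R = k}" for k
  have fin: "finite (rankings A)" using A by (rule finite_rankings)
  have W_le: "W k \<le> W (cyclic_Suc N k)" for k
    unfolding W_def
  proof (rule card_inj_on_le)
    let ?c = "\<lambda>R. restrict (cyclic_Suc N \<circ> R) A"
    show "?c ` {R \<in> rankings A. F R = k} \<subseteq> {R \<in> rankings A. F R = cyclic_Suc N k}"
      using eqv rankings_compose[OF _ bij_cyclic_Suc] by (auto simp: N_def)
    show "inj_on ?c {R \<in> rankings A. F R = k}"
    proof (rule inj_onI)
      fix R R' assume R: "R \<in> {R \<in> rankings A. F R = k}" "R' \<in> {R \<in> rankings A. F R = k}"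
        and eq: "?c R = ?c R'"
      show "R = R'"
      proof (rule PiE_ext[of R A "\<lambda>_. {1..card A}" R'])
        fix a assume a: "a \<in> A"
        have "cyclic_Suc N (R a) = cyclic_Suc N (R' a)"
          using fun_cong[OF eq, of a] a by simp
        moreover have "R a \<in> {1..N}" "R' a \<in> {1..N}"
          using R a by (auto simp: rankings_def N_def)
        ultimately show "R a = R' a"
          using bij_cyclic_Suc[of N] by (auto simp: bij_betw_def dest: inj_onD)
      qed (use R in \<open>auto simp: rankings_def\<close>)
    qed
  qed (use fin in auto)
  have up: "W i \<le> W j" if "1 \<le> i" "i \<le> j" "j \<le> N" for i j
    using that(2,3)
  proof (induction j rule: dec_induct)
    case (step j)
    then show ?case using W_le[of j] by (simp add: cyclic_Suc_def)
  qed simp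
  have "W N \<le> W 1" using W_le[of N] by (simp add: cyclic_Suc_def)
  then have const: "W i = W k" if "i \<in> {1..N}" for i
    using up[of 1 i] up[of i N] up[of 1 k] up[of k N] that k by (simp add: N_def)
  have "rankings A = (\<Union>i\<in>{1..N}. {R \<in> rankings A. F R = i})" using F by (auto simp: N_def)
  then have "card (rankings A) = card (\<Union>i\<in>{1..N}. {R \<in> rankings A. F R = i})" by simp
  also have "\<dots> = (\<Sum>i\<in>{1..N}. W i)"
    unfolding W_def using fin by (subst card_UN_disjoint) auto
  also have "\<dots> = N * W k" using const by simp
  finally show ?thesis by (simp add: N_def W_def)
qed

section \<open>Reversing single steps\<close>

text \<open>
  The number of rankings for which the walk with directions \<open>d\<close> ends at rank \<open>k\<close>.
\<close>

definition walk_count :: "nat \<Rightarrow> (nat \<Rightarrow> bool) \<Rightarrow> nat \<Rightarrow> nat" where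
  "walk_count n d k = card {R \<in> rankings (labels n). walk n d R = k}"

lemma walk_count_flip:
  assumes j: "j \<in> {1..n}" and k: "k \<in> {1..2 * n}"
  shows "n * (walk_count n d k + walk_count n (d(j := \<not> d j)) k) = card (rankings (labels n))"
proof -
  let ?d = "d(j := \<not> d j)" and ?S = "[Suc j..<Suc n]"
  let ?B = "rankings (labels n)"
  have fin: "finite ?B" by (simp add: finite_rankings)
  \<comment> \<open>The final rank of the walk that stands at the point labelled \<open>a\<close> after step \<open>j\<close>.\<close>
  define F where "F a R = foldl (clock_step R d) (R a) ?S" for a :: "nat + nat" and R :: "nat + nat \<Rightarrow> nat"
  have F: "2 * n * card {R \<in> ?B. F a R = k} = card ?B" if a: "a \<in> labels n" for a
  proof -
    have Ra: "R a \<in> {1..2 * n}" if "R \<in> ?B" for R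
      using that a rankings_labels(1) by blast
    have "F a R \<in> {1..2 * n}" if "R \<in> ?B" for R
      unfolding F_def using j Ra[OF that] rankings_labels(1)[OF that]
      by (intro foldl_clock_step_in[where n=n]) auto
    moreover have "F a (restrict (cyclic_Suc (2 * n) \<circ> R) (labels n)) = cyclic_Suc (2 * n) (F a R)"
      if "R \<in> ?B" for R
    proof -
      have "set ?S \<subseteq> {1..n}" using j by auto
      from foldl_clock_step_rotate[OF that this Ra[OF that], of d] show ?thesis
        using a by (simp add: F_def del: upt_Suc)
    qed
    ultimately show ?thesis
      using card_level_set_uniform[of "labels n" k "F a"] k by simp
  qed
  \<comment> \<open>The two walks agree before step \<open>j\<close>, then occupy the two points of pair \<open>j\<close>, in some order.\<close>
  have split: "(walk n d R = F (Inl j) R \<and> walk n ?d R = F (Inr j) R) \<or>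
      (walk n d R = F (Inr j) R \<and> walk n ?d R = F (Inl j) R)" for R
  proof -
    have "[1..<Suc n] = [1..<j] @ [j..<Suc n]"
      using j by (metis atLeastAtMost_iff le_SucI le_add_diff_inverse upt_add_eq_append)
    also have "[j..<Suc n] = j # ?S" using j by (simp add: upt_conv_Cons del: upt_Suc)
    finally have upt: "[1..<Suc n] = [1..<j] @ j # ?S" .
    have "foldl (clock_step R ?d) q js = foldl (clock_step R d) q js" if "j \<notin> set js" for q js
      using that by (intro foldl_cong) (auto simp: clock_step_def)
    then have eq: "foldl (clock_step R ?d) q [1..<j] = foldl (clock_step R d) q [1..<j]"
      "foldl (clock_step R ?d) q ?S = foldl (clock_step R d) q ?S" for q
      by auto
    define p where "p = foldl (clock_step R d) 0 [1..<j]"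
    have "walk n d R = foldl (clock_step R d) (clock_step R d p j) ?S"
      "walk n ?d R = foldl (clock_step R d) (clock_step R ?d p j) ?S"
      unfolding walk_def upt by (simp_all only: foldl_append foldl_Cons eq p_def)
    then show ?thesis by (auto simp: clock_step_def F_def)
  qed
  have ind: "card {R \<in> ?B. P R} = (\<Sum>R\<in>?B. if P R then 1 else 0)" for P
    using fin by (simp add: sum.If_cases Int_def)
  have "walk_count n d k + walk_count n ?d k
      = (\<Sum>R\<in>?B. (if walk n d R = k then 1 else 0) + (if walk n ?d R = k then 1 else 0))"
    unfolding walk_count_def ind by (simp add: sum.distrib)
  also have "\<dots> = (\<Sum>R\<in>?B. (if F (Inl j) R = k then 1 else 0) + (if F (Inr j) R = k then 1 else 0))"
  proof (intro sum.cong refl)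
    fix R
    show "(if walk n d R = k then 1 else 0) + (if walk n ?d R = k then 1 else 0)
      = (if F (Inl j) R = k then 1 else 0) + (if F (Inr j) R = k then 1 else (0::nat))"
      using split[of R] by (elim disjE conjE) (simp_all only: add.commute)
  qed
  also have "\<dots> = card {R \<in> ?B. F (Inl j) R = k} + card {R \<in> ?B. F (Inr j) R = k}"
    unfolding ind by (simp add: sum.distrib)
  finally have "2 * (n * (walk_count n d k + walk_count n ?d k)) = 2 * card ?B"
    using F[of "Inl j"] F[of "Inr j"] j by (simp add: algebra_simps)
  then show ?thesis by simp
qed

text \<open>
  Reversing the first \<open>m\<close> steps of the clockwise walk, one after the other.
\<close>

lemma walk_count_flip_prefix:
  assumes k: "k \<in> {1..2 * n}" and m: "m \<le> n"
  shows "card (rankings (labels n)) / (2 * real n) - walk_count n (\<lambda>i. m < i) k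
    = (- 1) ^ m * (card (rankings (labels n)) / (2 * real n) - walk_count n (\<lambda>i. 0 < i) k)"
proof -
  define c where "c = real (card (rankings (labels n)))"
  define W where "W m = real (walk_count n (\<lambda>i. m < i) k)" for m
  have flip: "c / (2 * real n) - W (Suc m) = - (c / (2 * real n) - W m)" if "Suc m \<le> n" for m
  proof -
    have n: "real n \<noteq> 0" using that by simp
    have d: "(\<lambda>i. m < i)(Suc m := \<not> m < Suc m) = (\<lambda>i. Suc m < i)"
      by (auto simp: fun_eq_iff)
    have "n * (walk_count n (\<lambda>i. m < i) k + walk_count n (\<lambda>i. Suc m < i) k) = card (rankings (labels n))"
      using walk_count_flip[of "Suc m" n k "\<lambda>i. m < i"] that k unfolding d by simp
    from arg_cong[OF this, of real] have "real n * (W m + W (Suc m)) = c"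
      by (simp only: of_nat_mult of_nat_add W_def c_def)
    then have "W m + W (Suc m) = c / real n" using n by (simp add: eq_divide_eq mult.commute)
    moreover have "c / (2 * real n) + c / (2 * real n) = c / real n" by simp
    ultimately show ?thesis by linarith
  qed
  have "c / (2 * real n) - W m = (- 1) ^ m * (c / (2 * real n) - W 0)"
    using m
  proof (induction m)
    case (Suc m)
    have "c / (2 * real n) - W (Suc m) = - ((- 1) ^ m * (c / (2 * real n) - W 0))"
      unfolding flip[OF Suc.prems] using Suc by (simp only: Suc_leD)
    then show ?case by simp
  qed simp
  then show ?thesis unfolding c_def W_def .
qed

section \<open>Reflecting the ranks\<close>

text \<open>
  Reflection reverses the cyclic order only away from coincidences: \<open>cyclic_le\<close> is not strict, and
  a point equal to \<open>p\<close> is the first one met from \<open>p\<close>, not the last.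
\<close>

lemma cyclic_le_reflect:
  assumes "p \<in> {1..N}" "y \<in> {1..N}" "z \<in> {1..N}" "y \<noteq> z" "p \<noteq> y" "p \<noteq> z"
  shows "cyclic_le (Suc N - p) (Suc N - y) (Suc N - z) \<longleftrightarrow> \<not> cyclic_le p y z"
  using assms unfolding cyclic_le_def by auto

lemma walk_reflect:
  assumes R: "R \<in> rankings (labels n)" and n: "1 \<le> n"
  shows "walk n d (restrict ((\<lambda>r. Suc (2 * n) - r) \<circ> R) (labels n)) = Suc (2 * n) - walk n (\<lambda>i. \<not> d i) R"
proof -
  let ?R = "restrict ((\<lambda>r. Suc (2 * n) - r) \<circ> R) (labels n)"
  have "walk m d ?R = Suc (2 * n) - walk m (\<lambda>i. \<not> d i) R" if "1 \<le> m" "m \<le> n" for m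
    using that
  proof (induction m rule: dec_induct)
    case base
    \<comment> \<open>The initial rank 0 is not reflected, but from it a clockwise step picks the smaller rank of the
      pair and an anticlockwise step the larger one, as reflection requires.\<close>
    then show ?case using n rankings_pair[OF R, of 1]
      by (auto simp: walk_def clock_step_def cyclic_le_def)
  next
    case (step m)
    define p where "p = walk m (\<lambda>i. \<not> d i) R"
    obtain a where a: "a \<in> {Inl m, Inr m}" "p = R a"
      using walk_eq_label[OF step.hyps(1)] unfolding p_def by metis
    have aL: "a \<in> labels n" using a step by auto
    have m: "Suc m \<in> {1..n}" using step by simp
    have p: "p \<in> {1..2 * n}" using a(2) aL rankings_labels(1)[OF R] by blast
    have ne: "p \<noteq> R (Inl (Suc m))" "p \<noteq> R (Inr (Suc m))"
      using a m unfolding a(2) by (auto simp: inj_on_eq_iff[OF rankings_labels(2)[OF R] aL])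
    have walk_Suc: "walk (Suc m) e Q = clock_step Q e (walk m e Q) (Suc m)" for e Q
      by (simp add: walk_def)
    have IH: "walk m d ?R = Suc (2 * n) - p"
      unfolding p_def by (rule step.IH) (use step.prems in simp)
    show ?case
      unfolding walk_Suc IH p_def[symmetric]
      using m cyclic_le_reflect[OF p rankings_pair[OF R m] ne]
      by (simp add: clock_step_def)
  qed
  then show ?thesis using n by simp
qed

lemma walk_count_reflect_le:
  assumes k: "k \<in> {1..2 * n}"
  shows "walk_count n (\<lambda>i. \<not> d i) k \<le> walk_count n d (2 * n + 1 - k)"
  unfolding walk_count_def
proof (rule card_inj_on_le)
  let ?c = "\<lambda>R. restrict ((\<lambda>r. Suc (2 * n) - r) \<circ> R) (labels n)"
  have "bij_betw (\<lambda>r. Suc (2 * n) - r) {1..2 * n} {1..2 * n}"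
    by (rule bij_betw_byWitness[where f'="\<lambda>r. Suc (2 * n) - r"]) auto
  then show "?c ` {R \<in> rankings (labels n). walk n (\<lambda>i. \<not> d i) R = k}
      \<subseteq> {R \<in> rankings (labels n). walk n d R = 2 * n + 1 - k}"
    using walk_reflect k rankings_compose[of _ "labels n"] by auto
  show "inj_on ?c {R \<in> rankings (labels n). walk n (\<lambda>i. \<not> d i) R = k}"
  proof (rule inj_onI)
    fix R R' assume R: "R \<in> {R \<in> rankings (labels n). walk n (\<lambda>i. \<not> d i) R = k}"
        "R' \<in> {R \<in> rankings (labels n). walk n (\<lambda>i. \<not> d i) R = k}"
      and eq: "?c R = ?c R'"
    show "R = R'"
    proof (rule PiE_ext[of R "labels n" "\<lambda>_. {1..2 * n}" R'])
      fix a assume a: "a \<in> labels n"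
      have "Suc (2 * n) - R a = Suc (2 * n) - R' a"
        using fun_cong[OF eq, of a] a by simp
      moreover have "R a \<in> {1..2 * n}" "R' a \<in> {1..2 * n}"
        using R a rankings_labels(1) by blast+
      ultimately show "R a = R' a" by auto
    qed (use R in \<open>auto simp: rankings_def\<close>)
  qed
qed (simp add: finite_rankings)

lemma walk_count_reflect:
  assumes k: "k \<in> {1..2 * n}"
  shows "walk_count n d (2 * n + 1 - k) = walk_count n (\<lambda>i. \<not> d i) k"
proof (rule antisym)
  show "walk_count n d (2 * n + 1 - k) \<le> walk_count n (\<lambda>i. \<not> d i) k"
  proof -
    have "2 * n + 1 - k \<in> {1..2 * n}" "2 * n + 1 - (2 * n + 1 - k) = k" using k by auto
    then show ?thesis
      using walk_count_reflect_le[of "2 * n + 1 - k" n "\<lambda>i. \<not> d i"] by (simp only: not_not)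
  qed
qed (rule walk_count_reflect_le[OF k])

lemma walk_count_symmetric:
  assumes k: "k \<in> {1..2 * n}"
  shows "card (rankings (labels n)) / (2 * real n) - walk_count n (\<lambda>_. True) (2 * n + 1 - k)
    = (- 1) ^ n * (card (rankings (labels n)) / (2 * real n) - walk_count n (\<lambda>_. True) k)"
proof -
  have 1: "walk_count n (\<lambda>i. 0 < i) k = walk_count n (\<lambda>_. True) k"
    unfolding walk_count_def using walk_cong[of n "\<lambda>i. 0 < i" "\<lambda>_. True"] by simp
  have "walk_count n (\<lambda>i. n < i) k = walk_count n (\<lambda>_. \<not> True) k"
    unfolding walk_count_def using walk_cong[of n "\<lambda>i. n < i" "\<lambda>_. \<not> True"] by simp
  then have 2: "walk_count n (\<lambda>i. n < i) k = walk_count n (\<lambda>_. True) (2 * n + 1 - k)"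
    using walk_count_reflect[OF k, of "\<lambda>_. True"] by (simp only:)
  show ?thesis using walk_count_flip_prefix[OF k order.refl] unfolding 1 2 .
qed

section \<open>The clock index as a function of the ranks\<close>

text \<open>
  In a sorted list the elements of a downward closed set form an initial segment.
\<close>

lemma sorted_nth_filter:
  assumes "sorted xs" "m < length xs" and down: "\<And>x y. x \<le> y \<Longrightarrow> P y \<Longrightarrow> P x"
  shows "m < length (filter P xs) \<longleftrightarrow> P (xs ! m)"
proof -
  define I where "I = {i. i < length xs \<and> P (xs ! i)}"
  have I: "length (filter P xs) = card I" "finite I"
    by (simp_all add: I_def length_filter_conv_card)
  show ?thesis
  proof
    assume "P (xs ! m)"
    then have "{..m} \<subseteq> I"
      using assms sorted_nth_mono[OF assms(1)] by (auto simp: I_def)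
    then have "card {..m} \<le> card I" using I by (intro card_mono)
    then show "m < length (filter P xs)" using I by simp
  next
    assume "m < length (filter P xs)"
    show "P (xs ! m)"
    proof (rule ccontr)
      assume "\<not> P (xs ! m)"
      then have "I \<subseteq> {..<m}"
        using assms sorted_nth_mono[OF assms(1)] unfolding I_def
        by (metis (mono_tags, lifting) lessThan_iff mem_Collect_eq not_le subsetI)
      then have "card I \<le> card {..<m}" by (intro card_mono) auto
      then show False using I \<open>m < length (filter P xs)\<close> by simp
    qed
  qed
qed

lemma sort_nth_eq_iff:
  assumes "m < length xs"
  shows "sort xs ! m = v \<longleftrightarrow>
    length (filter (\<lambda>x. x < v) xs) \<le> m \<and> m < length (filter (\<lambda>x. x \<le> v) xs)"
proof -
  have len: "length (filter P (sort xs)) = length (filter P xs)" for P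
    by (simp add: filter_sort)
  have "m < length (filter (\<lambda>x. x < v) xs) \<longleftrightarrow> sort xs ! m < v"
    using sorted_nth_filter[of "sort xs" m "\<lambda>x. x < v"] assms unfolding len by auto
  moreover have "m < length (filter (\<lambda>x. x \<le> v) xs) \<longleftrightarrow> sort xs ! m \<le> v"
    using sorted_nth_filter[of "sort xs" m "\<lambda>x. x \<le> v"] assms unfolding len by auto
  ultimately show ?thesis by auto
qed

text \<open>
  This holds without distinctness of the points; it also reduces measurability of the clock index to
  that of counting functions.
\<close>

lemma clock_order_stat_eq_iff:
  assumes "i \<in> {1..2 * n}"
  shows "clock_order_stat n u u' i = v \<longleftrightarrow>
    card {a \<in> labels n. case_sum u u' a < v} < i \<and> i \<le> card {a \<in> labels n. case_sum u u' a \<le> v}"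
proof -
  define as :: "(nat + nat) list" where "as = map Inl [1..<Suc n] @ map Inr [1..<Suc n]"
  have as: "set as = labels n" "distinct as"
    by (auto simp: as_def labels_def distinct_map inj_on_def simp del: upt_Suc)
  have eq: "map u [1..<Suc n] @ map u' [1..<Suc n] = map (case_sum u u') as"
    by (simp add: as_def del: upt_Suc)
  have len: "length (filter P (map (case_sum u u') as)) = card {a \<in> labels n. P (case_sum u u' a)}" for P
    using distinct_length_filter[OF as(2), of "\<lambda>a. P (case_sum u u' a)"]
    by (simp add: filter_map comp_def as Int_def conj_commute)
  have "length as = 2 * n" by (simp add: as_def)
  then have "i - 1 < length (map (case_sum u u') as)" using assms by auto
  from sort_nth_eq_iff[OF this, of v] show ?thesis
    unfolding clock_order_stat_def eq len using assms by auto
qed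

lemma clockwise_dist_le_iff:
  assumes "p \<in> {0..<1}" "y \<in> {0..<1}" "z \<in> {0..<1}"
  shows "clockwise_dist p y \<le> clockwise_dist p z \<longleftrightarrow> cyclic_le p y z"
proof -
  have "frac (w - p) = (if p \<le> w then w - p else w - p + 1)" if "w \<in> {0..<1}" for w
    using assms(1) that by (auto simp: frac_unique_iff)
  then show ?thesis using assms unfolding clockwise_dist_def cyclic_le_def by auto
qed

lemma clock_pos_eq_foldl:
  assumes "case_sum u u' ` labels n \<subseteq> {0..<1}" "k \<le> n"
  shows "clock_pos u u' k = foldl (clock_step (case_sum u u') (\<lambda>_. True)) 0 [1..<Suc k]"
  using assms(2)
proof (induction k)
  case (Suc k)
  define p where "p = foldl (clock_step (case_sum u u') (\<lambda>_. True)) 0 [1..<Suc k]"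
  have p: "p \<in> {0..<1}"
    unfolding p_def using assms(1) Suc.prems by (intro foldl_clock_step_in[where n=n]) auto
  have "case_sum u u' (Inl (Suc k)) \<in> {0..<1}" "case_sum u u' (Inr (Suc k)) \<in> {0..<1}"
    using Suc.prems by (intro subsetD[OF assms(1)] imageI; simp)+
  then have "first_clockwise p (u (Suc k)) (u' (Suc k)) = clock_step (case_sum u u') (\<lambda>_. True) p (Suc k)"
    using clockwise_dist_le_iff[OF p] by (simp add: first_clockwise_def clock_step_def)
  then show ?case using Suc unfolding p_def by simp
qed simp

text \<open>
  The walk on the points and the walk on their ranks choose the same labels. The starting positions 0
  carry no label, but 0 is a lower bound on both sides.
\<close>

lemma foldl_clock_step_rank_fn:
  fixes x :: "nat + nat \<Rightarrow> real" and d :: "nat \<Rightarrow> bool"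
  assumes "k \<le> n" "\<And>a. a \<in> labels n \<Longrightarrow> 0 \<le> x a"
  defines "p \<equiv> foldl (clock_step x d) 0 [1..<Suc k]"
    and "r \<equiv> foldl (clock_step (rank_fn (labels n) x) d) 0 [1..<Suc k]"
  shows "(k = 0 \<and> p = 0 \<and> r = 0) \<or> (\<exists>a\<in>{Inl k, Inr k}. p = x a \<and> r = rank_fn (labels n) x a)"
  using assms(1) unfolding p_def r_def
proof (induction k)
  case (Suc k)
  let ?R = "rank_fn (labels n) x"
  define p where "p = foldl (clock_step x d) 0 [1..<Suc k]"
  define r where "r = foldl (clock_step ?R d) 0 [1..<Suc k]"
  have le: "?R a \<le> ?R b \<longleftrightarrow> x a \<le> x b" if "a \<in> labels n" "b \<in> labels n" for a b
    using rank_fn_le_iff[OF finite_labels that] .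
  have k: "Inl (Suc k) \<in> labels n" "Inr (Suc k) \<in> labels n" using Suc.prems by auto
  have IH: "(k = 0 \<and> p = 0 \<and> r = 0) \<or> (\<exists>a\<in>{Inl k, Inr k}. p = x a \<and> r = ?R a)"
    using Suc unfolding p_def r_def by simp
  have "cyclic_le p (x (Inl (Suc k))) (x (Inr (Suc k))) = cyclic_le r (?R (Inl (Suc k))) (?R (Inr (Suc k)))"
  proof (cases "k = 0")
    case True
    then have "p = 0" "r = 0" by (auto simp: p_def r_def)
    then show ?thesis using assms(2) k le unfolding cyclic_le_def by simp
  next
    case False
    then obtain a where "a \<in> {Inl k, Inr k}" and eq: "p = x a" "r = ?R a" using IH by blast
    then have "a \<in> labels n" using False Suc.prems by auto
    then show ?thesis unfolding eq cyclic_le_def using k le by simp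
  qed
  then have "\<exists>a\<in>{Inl (Suc k), Inr (Suc k)}. clock_step x d p (Suc k) = x a \<and> clock_step ?R d r (Suc k) = ?R a"
    by (simp add: clock_step_def)
  moreover have "foldl (clock_step x d) 0 [1..<Suc (Suc k)] = clock_step x d p (Suc k)"
    "foldl (clock_step ?R d) 0 [1..<Suc (Suc k)] = clock_step ?R d r (Suc k)"
    by (simp_all add: p_def r_def)
  ultimately show ?case by metis
qed simp

lemma clock_index_eq_walk:
  assumes n: "1 \<le> n" and inj: "inj_on (case_sum u u') (labels n)"
    and range: "case_sum u u' ` labels n \<subseteq> {0..<1}"
  shows "clock_index n u u' n = walk n (\<lambda>_. True) (rank_fn (labels n) (case_sum u u'))"
proof -
  let ?x = "case_sum u u'"
  have nonneg: "0 \<le> ?x a" if "a \<in> labels n" for a using range that by (auto simp: image_subset_iff)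
  have "n \<noteq> 0" using n by simp
  then obtain a where a: "a \<in> {Inl n, Inr n}" "clock_pos u u' n = ?x a"
    "walk n (\<lambda>_. True) (rank_fn (labels n) ?x) = rank_fn (labels n) ?x a"
    using foldl_clock_step_rank_fn[where k=n and n=n and x="?x" and d="\<lambda>_. True", OF order.refl nonneg]
    unfolding clock_pos_eq_foldl[OF range order.refl] walk_def by blast
  have aL: "a \<in> labels n" using a n by auto
  let ?r = "card {b \<in> labels n. ?x b \<le> ?x a}"
  have r: "rank_fn (labels n) ?x a = ?r" using aL by (simp add: rank_fn_def)
  have "{b \<in> labels n. ?x b \<le> ?x a} = insert a {b \<in> labels n. ?x b < ?x a}"
    using inj aL by (auto simp: inj_on_def order.order_iff_strict)
  then have Suc: "?r = Suc (card {b \<in> labels n. ?x b < ?x a})" by simp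
  have "?r \<le> card (labels n)" by (intro card_mono) auto
  then have mem: "?r \<in> {1..2 * n}" using Suc by simp
  have iff: "i \<in> {1..2 * n} \<and> clock_order_stat n u u' i = clock_pos u u' n \<longleftrightarrow> i = ?r" for i
    using clock_order_stat_eq_iff[of i n u u' "?x a"] Suc mem unfolding a(2) by auto
  show ?thesis unfolding clock_index_def iff a(3) r by (rule Least_equality) simp_all
qed

lemma borel_measurable_clock_pos:
  assumes "\<And>a. a \<in> labels n \<Longrightarrow> case_sum U U' a \<in> borel_measurable M" "k \<le> n"
  shows "(\<lambda>\<omega>. clock_pos (\<lambda>i. U i \<omega>) (\<lambda>i. U' i \<omega>) k) \<in> borel_measurable M"
  using assms(2)
proof (induction k)
  case (Suc k)
  have [measurable]: "U (Suc k) \<in> borel_measurable M" "U' (Suc k) \<in> borel_measurable M"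
    using assms(1)[of "Inl (Suc k)"] assms(1)[of "Inr (Suc k)"] Suc.prems by auto
  have [measurable]: "(\<lambda>\<omega>. clock_pos (\<lambda>i. U i \<omega>) (\<lambda>i. U' i \<omega>) k) \<in> borel_measurable M"
    using Suc by simp
  show ?case unfolding clock_pos.simps first_clockwise_def clockwise_dist_def frac_def by measurable
qed simp

lemma sets_clock_index:
  assumes X: "\<And>a. a \<in> labels n \<Longrightarrow> case_sum U U' a \<in> borel_measurable M"
  shows "{\<omega> \<in> space M. clock_index n (\<lambda>i. U i \<omega>) (\<lambda>i. U' i \<omega>) n = k} \<in> sets M"
proof -
  let ?p = "\<lambda>\<omega>. clock_pos (\<lambda>i. U i \<omega>) (\<lambda>i. U' i \<omega>) n"
  have [measurable]: "?p \<in> borel_measurable M"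
    by (rule borel_measurable_clock_pos[OF X order.refl])
  have case_eq: "case_sum (\<lambda>i. U i \<omega>) (\<lambda>i. U' i \<omega>) a = case_sum U U' a \<omega>" for a \<omega>
    by (cases a) auto
  note [measurable] = X
  have [measurable]: "(\<lambda>\<omega>. card {a \<in> labels n. case_sum U U' a \<omega> < ?p \<omega>}) \<in> measurable M (count_space UNIV)"
    by (intro measurable_card_Collect) auto
  have [measurable]: "(\<lambda>\<omega>. card {a \<in> labels n. case_sum U U' a \<omega> \<le> ?p \<omega>}) \<in> measurable M (count_space UNIV)"
    by (intro measurable_card_Collect) auto
  have "clock_index n (\<lambda>i. U i \<omega>) (\<lambda>i. U' i \<omega>) n = (LEAST i. i \<in> {1..2 * n} \<and>
      card {a \<in> labels n. case_sum U U' a \<omega> < ?p \<omega>} < i \<and>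
      i \<le> card {a \<in> labels n. case_sum U U' a \<omega> \<le> ?p \<omega>})" for \<omega>
    unfolding clock_index_def
    by (intro arg_cong[where f=Least] ext conj_cong refl) (simp add: clock_order_stat_eq_iff case_eq)
  then show ?thesis by simp measurable
qed

section \<open>Symmetry of the final index\<close>

theorem mainTheorem5:
  fixes M :: "'a measure" and U U' :: "nat \<Rightarrow> 'a \<Rightarrow> real" and n :: nat
  assumes "prob_space M"
    and "n \<ge> 1"
    and "prob_space.indep_vars M (\<lambda>_. borel) (case_sum U U') ({1..n} <+> {1..n})"
    and "\<forall>i\<in>{1..n}. distr M borel (U i) = uniform_measure lborel {0..<1}"
    and "\<forall>i\<in>{1..n}. distr M borel (U' i) = uniform_measure lborel {0..<1}"
  shows "\<forall>k\<in>{1..2 * n}.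
    clock_delta M n U U' (2 * n + 1 - k) = (-1) ^ n * clock_delta M n U U' k"
proof -
  interpret prob_space M by fact
  let ?X = "case_sum U U'" and ?A = "labels n" and ?D = "uniform_measure lborel {0..<1::real}"
  define c where "c = real (card (rankings ?A))"
  have c: "c \<noteq> 0" using rankings_nonempty[of ?A] by (simp add: c_def finite_rankings)
  have ne: "?A \<noteq> {}" using assms(2) Inl_in_labels[of 1 n] by force
  have ind: "indep_vars (\<lambda>_. borel) ?X ?A" using assms(3) by (simp add: labels_def)
  have D: "distr M borel (?X a) = ?D" if "a \<in> ?A" for a
    using that assms(4,5) by (auto simp: labels_def)
  have Xm: "?X a \<in> borel_measurable M" if "a \<in> ?A" for a
    using ind that by (simp add: indep_vars_def2)
  have atomless: "emeasure ?D {t} = 0" for t :: real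
  proof -
    have "emeasure lborel ({0..<1} \<inter> {t}) \<le> emeasure lborel {t}"
      by (intro emeasure_mono) auto
    then show ?thesis by simp
  qed
  have "AE \<omega> in M. ?X a \<omega> \<in> {0..<1}" if "a \<in> ?A" for a
  proof (rule AE_distrD[OF Xm[OF that]])
    show "AE t in distr M borel (?X a). t \<in> {0..<1}"
      unfolding D[OF that] by (rule AE_uniform_measureI) auto
  qed
  then have range: "AE \<omega> in M. \<forall>a\<in>?A. ?X a \<omega> \<in> {0..<1}"
    by (intro AE_finite_allI) auto
  have inj: "AE \<omega> in M. inj_on (\<lambda>a. ?X a \<omega>) ?A"
    using D atomless by (intro AE_inj_on_indep_vars ind) auto
  have case_eq: "case_sum (\<lambda>i. U i \<omega>) (\<lambda>i. U' i \<omega>) = (\<lambda>a. ?X a \<omega>)" for \<omega>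
    by (auto simp: fun_eq_iff split: sum.split)
  have index: "AE \<omega> in M. clock_index n (\<lambda>i. U i \<omega>) (\<lambda>i. U' i \<omega>) n
      = walk n (\<lambda>_. True) (rank_fn ?A (\<lambda>a. ?X a \<omega>)) \<and> rank_fn ?A (\<lambda>a. ?X a \<omega>) \<in> rankings ?A"
    using range inj
  proof eventually_elim
    case (elim \<omega>)
    then show ?case
      using clock_index_eq_walk[OF assms(2), of "\<lambda>i. U i \<omega>" "\<lambda>i. U' i \<omega>"]
        rank_fn_in_rankings[of ?A "\<lambda>a. ?X a \<omega>"]
      unfolding case_eq by (simp add: image_subset_iff)
  qed
  have prob: "prob {\<omega> \<in> space M. clock_index n (\<lambda>i. U i \<omega>) (\<lambda>i. U' i \<omega>) n = k}
      = walk_count n (\<lambda>_. True) k / c" for k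
  proof -
    let ?S = "{R \<in> rankings ?A. walk n (\<lambda>_. True) R = k}"
    note uniform = prob_rank_fn_in[OF finite_labels ne ind D atomless, of ?S]
    have "prob {\<omega> \<in> space M. clock_index n (\<lambda>i. U i \<omega>) (\<lambda>i. U' i \<omega>) n = k}
        = prob {\<omega> \<in> space M. rank_fn ?A (\<lambda>a. ?X a \<omega>) \<in> ?S}"
    proof (rule finite_measure_eq_AE)
      show "AE \<omega> in M. \<omega> \<in> {\<omega> \<in> space M. clock_index n (\<lambda>i. U i \<omega>) (\<lambda>i. U' i \<omega>) n = k}
          \<longleftrightarrow> \<omega> \<in> {\<omega> \<in> space M. rank_fn ?A (\<lambda>a. ?X a \<omega>) \<in> ?S}"
        using index by eventually_elim auto
    qed (use sets_clock_index[OF Xm] uniform(1) in auto)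
    also have "\<dots> = walk_count n (\<lambda>_. True) k / c"
      using uniform(2) by (auto simp: walk_count_def c_def)
    finally show ?thesis .
  qed
  have delta: "clock_delta M n U U' k = (c / (2 * real n) - walk_count n (\<lambda>_. True) k) / c" for k
    using c by (simp add: clock_delta_def prob diff_divide_distrib)
  show ?thesis
    unfolding delta using walk_count_symmetric[of _ n] by (auto simp: c_def)
qed

end
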